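(* Let $V=\langle f_1,f_2,\dots,f_{n+1}\rangle$ be an $(n+1)$-dimensional graded thread $W^+$-module such that there exist integers $k,p$ with $1\le k<k+p\le n$, $p\ge2$, and $$e_1f_k=e_1f_{k+p}=0.$$ Then $e_nf_1=0$.
   Context: $\mathbb K$ is $\mathbb R$ or $\mathbb C$. $W^+$ is the Lie algebra over $\mathbb K$ with basis $e_1,e_2,e_3,\dots$ and bracket $[e_i,e_j]=(j-i)e_{i+j}$. An $(n+1)$-dimensional graded thread $W^+$-module is a $W^+$-module $V$ with a basis $f_1,\dots,f_{n+1}$ such that $e_if_j\in\langle f_{i+j}\rangle$ for all $i\ge1$, with $f_m=0$ for $m>n+1$. *)

theory Defs
  imports Complex_Main "HOL-Computational_Algebra.Polynomial"
begin

locale lie_algebra = vector_space scale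
  for scale :: "'k::field \<Rightarrow> 'g::ab_group_add \<Rightarrow> 'g" +
  fixes bracket :: "'g \<Rightarrow> 'g \<Rightarrow> 'g"
  assumes linear_bracket_left: "Vector_Spaces.linear scale scale (\<lambda>x. bracket x y)"
    and linear_bracket_right: "Vector_Spaces.linear scale scale (bracket x)"
    and bracket_self: "bracket x x = 0"
    and jacobi: "bracket x (bracket y z) + bracket y (bracket z x) + bracket z (bracket x y) = 0"

locale lie_module =
  L: lie_algebra scaleL bracket + V: vector_space scaleV
  for scaleL :: "'k::field \<Rightarrow> 'g::ab_group_add \<Rightarrow> 'g"
    and bracket :: "'g \<Rightarrow> 'g \<Rightarrow> 'g"
    and scaleV :: "'k \<Rightarrow> 'v::ab_group_add \<Rightarrow> 'v" +
  fixes act :: "'g \<Rightarrow> 'v \<Rightarrow> 'v"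
  assumes linear_act_left: "Vector_Spaces.linear scaleL scaleV (\<lambda>x. act x v)"
    and linear_act_right: "Vector_Spaces.linear scaleV scaleV (act x)"
    and act_bracket: "act (bracket x y) v = act x (act y v) - act y (act x v)"

text \<open>
  The algebra \<open>W\<^sup>+\<close>, presented by its basis \<open>e 1, e 2, \<dots>\<close> and structure constants, which
  determine it up to isomorphism. The value \<open>e 0\<close> is junk.
\<close>
locale wplus_algebra = lie_algebra scale bracket
  for scale :: "'k::field \<Rightarrow> 'g::ab_group_add \<Rightarrow> 'g"
    and bracket :: "'g \<Rightarrow> 'g \<Rightarrow> 'g" +
  fixes e :: "nat \<Rightarrow> 'g"
  assumes inj_e: "inj_on e {1..}"
    and independent_e: "independent (e ` {1..})"
    and span_e: "span (e ` {1..}) = UNIV"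
    and bracket_e: "1 \<le> i \<Longrightarrow> 1 \<le> j \<Longrightarrow>
      bracket (e i) (e j) = scale (of_int (int j - int i)) (e (i + j))"

text \<open>
  The module is the whole type \<open>'v\<close>, with basis \<open>f 1, \<dots>, f (n + 1)\<close>; the value \<open>f 0\<close> is junk.
\<close>
locale graded_thread_wplus_module =
  wplus_algebra scaleL bracket e + lie_module scaleL bracket scaleV act
  for scaleL :: "'k::field \<Rightarrow> 'g::ab_group_add \<Rightarrow> 'g"
    and bracket :: "'g \<Rightarrow> 'g \<Rightarrow> 'g"
    and e :: "nat \<Rightarrow> 'g"
    and scaleV :: "'k \<Rightarrow> 'v::ab_group_add \<Rightarrow> 'v"
    and act :: "'g \<Rightarrow> 'v \<Rightarrow> 'v" +
  fixes n :: nat and f :: "nat \<Rightarrow> 'v"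
  assumes inj_f: "inj_on f {1..n+1}"
    and independent_f: "V.independent (f ` {1..n+1})"
    and span_f: "V.span (f ` {1..n+1}) = UNIV"
    and f_beyond: "m > n + 1 \<Longrightarrow> f m = 0"
    and act_e_f: "1 \<le> i \<Longrightarrow> 1 \<le> j \<Longrightarrow> j \<le> n + 1 \<Longrightarrow> act (e i) (f j) \<in> V.span {f (i + j)}"

text \<open>
  A model of \<open>W\<^sup>+\<close>: the polynomial \<open>x\<close> stands for the vector field \<open>t\<^sup>2 x(t) d/dt\<close>, so that
  \<open>e i\<close> is \<open>t\<^bsup>i+1\<^esup> d/dt\<close>.
\<close>
lemma wplus_algebra_poly:
  "wplus_algebra (smult :: 'k::field \<Rightarrow> _)
     (\<lambda>x y. monom 1 2 * (x * pderiv y - pderiv x * y)) (\<lambda>i. monom 1 (i - 1))"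
proof -
  interpret V: vector_space "smult :: 'k \<Rightarrow> _"
    by unfold_locales (auto simp: smult_add_right smult_add_left)
  let ?e = "\<lambda>i::nat. monom (1::'k) (i - 1)"
  have im: "?e ` {1..} = range (monom 1)"
  proof -
    have "monom 1 m \<in> ?e ` {1..}" for m
      by (rule image_eqI[of _ _ "m + 1"]) auto
    then show ?thesis by auto
  qed
  have inj: "inj (monom (1::'k))"
    by (rule injI) (metis degree_monom_eq one_neq_zero)
  have indep: "V.independent (range (monom (1::'k)))"
    unfolding V.independent_explicit_module
  proof (intro allI impI)
    fix T :: "'k poly set" and u q
    assume T: "finite T" "T \<subseteq> range (monom 1)" "(\<Sum>v\<in>T. smult (u v) v) = 0" "q \<in> T"
    then obtain m where m: "q = monom 1 m" by auto
    have "0 = coeff (\<Sum>v\<in>T. smult (u v) v) m" using T by simp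
    also have "\<dots> = (\<Sum>v\<in>T. if v = q then u q else 0)"
      unfolding coeff_sum
    proof (rule sum.cong)
      fix v assume "v \<in> T"
      then obtain l where "v = monom 1 l" using T by auto
      then show "coeff (smult (u v) v) m = (if v = q then u q else 0)"
        using m inj by (auto simp: inj_eq)
    qed simp
    finally show "u q = 0" using T by simp
  qed
  have span: "V.span (range (monom (1::'k))) = UNIV"
  proof -
    have "q \<in> V.span (range (monom (1::'k)))" for q
    proof -
      have "(\<Sum>i\<le>degree q. smult (coeff q i) (monom 1 i)) \<in> V.span (range (monom (1::'k)))"
        by (intro V.span_sum V.span_scale V.span_base) auto
      then show ?thesis by (simp add: smult_monom poly_as_sum_of_monoms)
    qed
    then show ?thesis by auto
  qed
  show ?thesis
  proof unfold_locales
    show "inj_on ?e {1..}"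
    proof (rule inj_onI)
      fix i j :: nat assume "i \<in> {1..}" "j \<in> {1..}" "?e i = ?e j"
      then show "i = j" using injD[OF inj, of "i - 1" "j - 1"] by auto
    qed
    show "V.independent (?e ` {1..})" unfolding im by (rule indep)
    show "V.span (?e ` {1..}) = UNIV" unfolding im by (rule span)
    fix i j :: nat assume "1 \<le> i" "1 \<le> j"
    then obtain a b where "i = Suc a" "j = Suc b" by (metis Suc_le_D One_nat_def)
    then show "monom 1 2 * (?e i * pderiv (?e j) - pderiv (?e i) * ?e j)
      = smult (of_int (int j - int i)) (?e (i + j))"
      by (cases a; cases b)
        (auto simp: pderiv_monom mult_monom smult_monom monom_0 algebra_simps add_monom diff_monom
          minus_monom pderiv_pCons numeral_2_eq_2)
  qed (auto simp: algebra_simps pderiv_add pderiv_smult pderiv_mult pderiv_diff pderiv_minus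
        smult_add_right smult_diff_right)
qed

end

theory Submission
  imports Defs
begin

text \<open>
  Up to a nonzero factor, \<open>e i\<close> with \<open>i \<ge> 2\<close> is an iterated commutator of one \<open>e 2\<close> with copies
  of \<open>e 1\<close>. Hence \<open>e i\<close> acts on \<open>f j\<close> by a combination of products consisting of one
  \<open>e 2\<close> and \<open>i - 2\<close> factors \<open>e 1\<close>. The single \<open>e 2\<close> jumps over only two consecutive
  steps, so for \<open>p \<ge> 2\<close> no product avoids both vanishing steps at \<open>k\<close> and \<open>k + p\<close>.
\<close>

lemma act_e_f_eq_0_if_crosses_two_zeros:
  fixes scaleL :: "'k::field_char_0 \<Rightarrow> 'g::ab_group_add \<Rightarrow> 'g"
    and scaleV :: "'k \<Rightarrow> 'v::ab_group_add \<Rightarrow> 'v"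
  assumes M: "graded_thread_wplus_module scaleL bracket e scaleV act n f"
    and "k + p \<le> n" "p \<ge> 2"
    and zero_k: "act (e 1) (f k) = 0" and zero_kp: "act (e 1) (f (k + p)) = 0"
    and "2 \<le> i" "1 \<le> j" "j \<le> k" "k + p < j + i"
  shows "act (e i) (f j) = 0"
proof -
  interpret graded_thread_wplus_module scaleL bracket e scaleV act n f by (rule M)
  \<comment> \<open>The grading fixes \<open>act (e i) (f j)\<close> only up to an unknown scalar;
    linearity lets vanishing on \<open>f (i + j)\<close> pass to it.\<close>
  have act_span: "act x v = 0" if "v \<in> V.span {w}" "act x w = 0" for x v w
  proof -
    interpret A: Vector_Spaces.linear scaleV scaleV "act x" by (rule linear_act_right)
    from that(1) obtain c where "v = scaleV c w" by (auto simp: V.span_singleton)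
    with that(2) show ?thesis by (simp add: A.scale)
  qed
  have act_0: "act x 0 = 0" for x
  proof -
    interpret A: Vector_Spaces.linear scaleV scaleV "act x" by (rule linear_act_right)
    show ?thesis by (rule A.zero)
  qed
  show ?thesis
    using \<open>2 \<le> i\<close> \<open>1 \<le> j\<close> \<open>j \<le> k\<close> \<open>k + p < j + i\<close>
  \<comment> \<open>\<open>j\<close> must vary: the two terms of the commutator of
    \<open>e 1\<close> and \<open>e i\<close> need the hypothesis at \<open>j\<close> and at
    \<open>1 + j\<close>.\<close>
  proof (induction i arbitrary: j rule: dec_induct)
    case base
    \<comment> \<open>Vacuous: \<open>j \<le> k\<close> and \<open>k + p < j + 2\<close> would force
      \<open>p < 2\<close>.\<close>
    then show ?case using \<open>p \<ge> 2\<close> by simp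
  next
    case (step i)
    \<comment> \<open>Either \<open>e i\<close> lands exactly on the line of
      \<open>f (k + p)\<close>, which \<open>e 1\<close> kills, or it already passes beyond
      \<open>k + p\<close> and the induction hypothesis applies.\<close>
    have "act (e 1) (act (e i) (f j)) = 0"
    proof (cases "k + p = j + i")
      case True
      have "act (e i) (f j) \<in> V.span {f (i + j)}"
        using step.hyps step.prems \<open>k + p \<le> n\<close> by (intro act_e_f) auto
      moreover have "act (e 1) (f (i + j)) = 0"
        using zero_kp unfolding True by (simp only: add.commute)
      ultimately show ?thesis by (rule act_span)
    next
      case False
      then have "act (e i) (f j) = 0" using step by simp
      then show ?thesis by (simp add: act_0)
    qed
    \<comment> \<open>Either \<open>e 1\<close> acts at the zero \<open>k\<close>, or the start
      moves to \<open>1 + j\<close>, still at most \<open>k\<close>, while the endpoint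
      \<open>i + j + 1\<close> stays beyond \<open>k + p\<close>.\<close>
    moreover have "act (e i) (act (e 1) (f j)) = 0"
    proof (cases "j = k")
      case True
      then show ?thesis using zero_k by (simp add: act_0)
    next
      case False
      have "act (e 1) (f j) \<in> V.span {f (1 + j)}"
        using step.prems \<open>k + p \<le> n\<close> by (intro act_e_f) auto
      moreover have "act (e i) (f (1 + j)) = 0" using step False by simp
      ultimately show ?thesis by (rule act_span)
    qed
    ultimately have "act (bracket (e 1) (e i)) (f j) = 0"
      by (simp add: act_bracket)
    moreover have "bracket (e 1) (e i) = scaleL (of_int (int i - 1)) (e (Suc i))"
      using bracket_e[of 1 i] step.hyps by simp
    moreover have "act (scaleL c x) v = scaleV c (act x v)" for c x v
    proof -
      interpret A: Vector_Spaces.linear scaleL scaleV "\<lambda>x. act x v" by (rule linear_act_left)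
      show ?thesis by (rule A.scale)
    qed
    \<comment> \<open>Characteristic 0 and \<open>i \<ge> 2\<close> allow division by the structure
      constant, isolating \<open>e (Suc i)\<close>.\<close>
    moreover have "of_int (int i - 1) \<noteq> (0::'k)"
      unfolding of_int_eq_0_iff using step.hyps by simp
    ultimately show ?case by simp
  qed
qed

theorem lemma2p2:
  "(\<forall>(scaleL :: real \<Rightarrow> 'g::ab_group_add \<Rightarrow> 'g) bracket e
      (scaleV :: real \<Rightarrow> 'v::ab_group_add \<Rightarrow> 'v) act n f k p.
      graded_thread_wplus_module scaleL bracket e scaleV act n f \<longrightarrow>
      1 \<le> k \<longrightarrow> k < k + p \<longrightarrow> k + p \<le> n \<longrightarrow> p \<ge> 2 \<longrightarrow>
      act (e 1) (f k) = 0 \<longrightarrow> act (e 1) (f (k + p)) = 0 \<longrightarrow>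
      act (e n) (f 1) = 0) \<and>
   (\<forall>(scaleL :: complex \<Rightarrow> 'h::ab_group_add \<Rightarrow> 'h) bracket e
      (scaleV :: complex \<Rightarrow> 'w::ab_group_add \<Rightarrow> 'w) act n f k p.
      graded_thread_wplus_module scaleL bracket e scaleV act n f \<longrightarrow>
      1 \<le> k \<longrightarrow> k < k + p \<longrightarrow> k + p \<le> n \<longrightarrow> p \<ge> 2 \<longrightarrow>
      act (e 1) (f k) = 0 \<longrightarrow> act (e 1) (f (k + p)) = 0 \<longrightarrow>
      act (e n) (f 1) = 0)"
proof (intro conjI allI impI)
  fix scaleL :: "real \<Rightarrow> 'g \<Rightarrow> 'g" and bracket e
    and scaleV :: "real \<Rightarrow> 'v \<Rightarrow> 'v" and act n f and k p :: nat
  assume "graded_thread_wplus_module scaleL bracket e scaleV act n f"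
    "1 \<le> k" "k + p \<le> n" "p \<ge> 2" "act (e 1) (f k) = 0" "act (e 1) (f (k + p)) = 0"
  then show "act (e n) (f 1) = 0"
    \<comment> \<open>Take \<open>i = n\<close> and \<open>j = 1\<close>: the endpoint
      \<open>n + 1\<close> lies beyond \<open>k + p\<close> because
      \<open>k + p \<le> n\<close>.\<close>
    by - (rule act_e_f_eq_0_if_crosses_two_zeros[of scaleL bracket e scaleV act n f k p], simp_all)
next
  fix scaleL :: "complex \<Rightarrow> 'h \<Rightarrow> 'h" and bracket e
    and scaleV :: "complex \<Rightarrow> 'w \<Rightarrow> 'w" and act n f and k p :: nat
  assume "graded_thread_wplus_module scaleL bracket e scaleV act n f"
    "1 \<le> k" "k + p \<le> n" "p \<ge> 2" "act (e 1) (f k) = 0" "act (e 1) (f (k + p)) = 0"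
  then show "act (e n) (f 1) = 0"
    by - (rule act_e_f_eq_0_if_crosses_two_zeros[of scaleL bracket e scaleV act n f k p], simp_all)
qed

end
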